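(* Let $\mathcal{I}_1,\mathcal{I}_2\in\mathcal{I}_n(\Omega,\mathcal{U})$. If $\mathcal{I}_1\sim_u\mathcal{I}_2$, then for all $\lambda\in\Omega$ and all $I,J\in\mathbb{Z}_+^m$, $$\mathscr{K}_{I,J}(\mathcal{I}_1)(\lambda)\sim_u\mathscr{K}_{I,J}(\mathcal{I}_2)(\lambda),$$ i.e. these two operators are unitarily equivalent (the two covariant derivatives being taken along the same order of differentiation).
   Context: Setting. $\Omega\subseteq\mathbb{C}^m$ is a domain, $\partial_i=\partial/\partial\lambda_i$, $\overline\partial_j=\partial/\partial\overline\lambda_j$, $\partial=\sum_{i=1}^m\partial_i$, $\overline\partial=\sum_{j=1}^m\overline\partial_j$. $B$ is a unital $C^*$-algebra, $l^2(\mathbb{N},B)=\{(a_i)_{i\in\mathbb{N}}: a_i\in B,\ \sum_i\|a_i\|^2<\infty\}$ with $B$-valued inner product $\langle a,b\rangle=\sum_i b_i^*a_i$, and $\mathcal{U}$ is the algebra of bounded linear operators on $l^2(\mathbb{N},B)$. $\mathcal{I}_n(\Omega,\mathcal{U})$ is the set of maps $\mathcal{I}:\Omega\to\mathcal{U}$ of the form $\mathcal{I}(\lambda)=F(\lambda)(G^*(\lambda)F(\lambda))^{-1}G^*(\lambda)$, where $F_1,\dots,F_n,G_1,\dots,G_n:\Omega\to l^2(\mathbb{N},B)$ are holomorphic, $F(\lambda)\xi=\sum_iF_i(\lambda)\xi_i$ for $\xi\in B^n$, $G^*(\lambda)x=(\langle x,G_i(\lambda)\rangle)_{i=1}^n$,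 and $G^*(\lambda)F(\lambda)=(\langle F_j(\lambda),G_i(\lambda)\rangle)_{i,j}$ is invertible for every $\lambda$. A unitary in $\mathcal{U}$ is an invertible $U\in\mathcal{U}$ preserving the inner product. $\mathcal{I}_1\sim_u\mathcal{I}_2$ means there is a unitary $U\in\mathcal{U}$ with $U\mathcal{I}_1(\lambda)=\mathcal{I}_2(\lambda)U$ for all $\lambda\in\Omega$; for operators, $A\sim_uA'$ means $UA=A'U$ for some unitary $U\in\mathcal{U}$. Curvature: $\mathscr{K}(\mathcal{I})=(\overline\partial\mathcal{I})(\partial\mathcal{I})$. Covariant derivatives depend on an order of differentiation. For $I=(i_1,\dots,i_m)$, $J=(j_1,\dots,j_m)\in\mathbb{Z}_+^m$, an order is a finite word $w$ in letters $1,\dots,m,\overline1,\dots,\overline m$ containing $p$ exactly $i_p$ times and $\overline q$ exactly $j_q$ times (applied from left to right). $\mathscr{K}_{I,J}(\mathcal{I})$ along $w$ is denoted $\mathscr{K}_w$ and defined recursively by: $\mathscr{K}_\emptyset=\mathscr{K}(\mathcal{I})$; $$\mathscr{K}_{w\,l}=\mathscr{K}_{w'}+\mathcal{I}\,\partial_l(\mathscr{K}_{w''}),$$ where $w'$ is $w$ with all letters $l$ deleted and $w''$ is $w$ with all unbarred letters other than $l$ deleted, the first term being omitted if $w$ contains no unbarred letter other than $l$; and $$\mathscr{K}_{w\,\overline k}=\mathscr{K}_{w'}+\overline\partial_k(\mathscr{K}_{w''})\,\mathcal{I},$$ where $w'$ is $w$ with all letters $\overline k$ deleted and $w''$ is $w$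 with all barred letters other than $\overline k$ deleted, the first term being omitted if $w$ contains no barred letter other than $\overline k$. *)

theory Defs
  imports "HOL-Analysis.Analysis"
begin

section \<open>Complex normed spaces and unital \<open>C\<^sup>*\<close>-algebras\<close>

class complex_normed_vector = real_normed_vector +
  fixes scaleC :: "complex \<Rightarrow> 'a \<Rightarrow> 'a"  (infixr \<open>*\<^sub>C\<close> 75)
  assumes scaleC_add_right: "c *\<^sub>C (x + y) = c *\<^sub>C x + c *\<^sub>C y"
    and scaleC_add_left: "(c + d) *\<^sub>C x = c *\<^sub>C x + d *\<^sub>C x"
    and scaleC_scaleC: "c *\<^sub>C d *\<^sub>C x = (c * d) *\<^sub>C x"
    and scaleC_of_real: "complex_of_real r *\<^sub>C x = r *\<^sub>R x"
    and norm_scaleC: "norm (c *\<^sub>C x) = cmod c * norm x"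

class cstar_algebra = complex_normed_vector + real_normed_algebra_1 + banach +
  fixes adj :: "'a \<Rightarrow> 'a"
  assumes scaleC_mult_left: "(c *\<^sub>C x) * y = c *\<^sub>C (x * y)"
    and scaleC_mult_right: "x * (c *\<^sub>C y) = c *\<^sub>C (x * y)"
    and adj_adj: "adj (adj x) = x"
    and adj_add: "adj (x + y) = adj x + adj y"
    and adj_scaleC: "adj (c *\<^sub>C x) = cnj c *\<^sub>C adj x"
    and adj_mult: "adj (x * y) = adj y * adj x"
    and cstar_identity: "norm (adj x * x) = (norm x)\<^sup>2"

lemma scaleC_one: "1 *\<^sub>C x = (x :: 'a :: complex_normed_vector)"
  using scaleC_of_real[of 1 x] by simp

lemma bounded_linear_scaleC: "bounded_linear (\<lambda>x :: 'a :: complex_normed_vector. c *\<^sub>C x)"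
proof (rule bounded_linear_intro[where K = "cmod c"])
  fix r and x :: 'a
  show "c *\<^sub>C r *\<^sub>R x = r *\<^sub>R c *\<^sub>C x"
    by (simp add: scaleC_of_real[symmetric] scaleC_scaleC mult.commute)
qed (simp_all add: scaleC_add_right norm_scaleC mult.commute)

instantiation blinfun :: (real_normed_vector, complex_normed_vector) complex_normed_vector
begin

lift_definition scaleC_blinfun :: "complex \<Rightarrow> ('a \<Rightarrow>\<^sub>L 'b) \<Rightarrow> ('a \<Rightarrow>\<^sub>L 'b)"
  is "\<lambda>c T x. c *\<^sub>C T x"
  by (rule bounded_linear_compose[OF bounded_linear_scaleC])

instance
proof
  fix c d :: complex and r :: real and S T :: "'a \<Rightarrow>\<^sub>L 'b"
  show "c *\<^sub>C (S + T) = c *\<^sub>C S + c *\<^sub>C T"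
    by transfer (simp add: scaleC_add_right)
  show "(c + d) *\<^sub>C T = c *\<^sub>C T + d *\<^sub>C T"
    by transfer (simp add: scaleC_add_left)
  show mult: "c *\<^sub>C d *\<^sub>C T = (c * d) *\<^sub>C T" for c d and T :: "'a \<Rightarrow>\<^sub>L 'b"
    by transfer (simp add: scaleC_scaleC)
  show of_real: "complex_of_real r *\<^sub>C T = r *\<^sub>R T" for r and T :: "'a \<Rightarrow>\<^sub>L 'b"
    by transfer (simp add: scaleC_of_real)
  have le: "norm (c *\<^sub>C T) \<le> cmod c * norm T" for c and T :: "'a \<Rightarrow>\<^sub>L 'b"
    by (rule norm_blinfun_bound)
      (simp_all add: scaleC_blinfun.rep_eq norm_scaleC mult.assoc mult_left_mono norm_blinfun)
  show "norm (c *\<^sub>C T) = cmod c * norm T"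
  proof (cases "c = 0")
    case True
    then show ?thesis using of_real[of 0 T] by simp
  next
    case False
    have "norm T = norm (inverse c *\<^sub>C c *\<^sub>C T)"
      using False of_real[of 1 T] by (simp add: mult)
    also have "\<dots> \<le> inverse (cmod c) * norm (c *\<^sub>C T)"
      using le[of "inverse c"] by (simp add: norm_inverse)
    finally have "cmod c * norm T \<le> norm (c *\<^sub>C T)"
      using False by (simp add: field_simps)
    with le[of c T] show ?thesis by simp
  qed
qed

end


section \<open>The space \<open>l\<^sup>2(\<nat>,B)\<close>\<close>

typedef (overloaded) 'b l2 =
  "{a :: nat \<Rightarrow> 'b :: real_normed_vector. summable (\<lambda>i. (norm (a i))\<^sup>2)}"
  morphisms l2_nth Abs_l2
  by (rule exI[of _ "\<lambda>_. 0"]) simp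

setup_lifting type_definition_l2

lemma l2_summable_add:
  fixes a b :: "nat \<Rightarrow> 'b :: real_normed_vector"
  assumes a: "summable (\<lambda>i. (norm (a i))\<^sup>2)" and b: "summable (\<lambda>i. (norm (b i))\<^sup>2)"
  shows "summable (\<lambda>i. (norm (a i + b i))\<^sup>2)"
    and "sqrt (\<Sum>i. (norm (a i + b i))\<^sup>2) \<le>
           sqrt (\<Sum>i. (norm (a i))\<^sup>2) + sqrt (\<Sum>i. (norm (b i))\<^sup>2)" (is "_ \<le> ?A + ?B")
proof -
  have nonneg: "0 \<le> ?A + ?B"
    by (intro add_nonneg_nonneg real_sqrt_ge_zero suminf_nonneg a b) auto
  have bound: "(\<Sum>i<n. (norm (a i + b i))\<^sup>2) \<le> (?A + ?B)\<^sup>2" for n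
  proof -
    have "sqrt (\<Sum>i<n. (norm (a i + b i))\<^sup>2) \<le> L2_set (\<lambda>i. norm (a i) + norm (b i)) {..<n}"
      unfolding L2_set_def
      by (intro real_sqrt_le_mono sum_mono power_mono norm_triangle_ineq) auto
    also have "\<dots> \<le> L2_set (\<lambda>i. norm (a i)) {..<n} + L2_set (\<lambda>i. norm (b i)) {..<n}"
      by (rule L2_set_triangle_ineq)
    also have "\<dots> \<le> ?A + ?B"
      unfolding L2_set_def
      by (intro add_mono real_sqrt_le_mono sum_le_suminf a b) auto
    finally show ?thesis
      by (rule sqrt_le_D)
  qed
  show *: "summable (\<lambda>i. (norm (a i + b i))\<^sup>2)"
    using bound by (intro summableI_nonneg_bounded) auto
  have "(\<Sum>i. (norm (a i + b i))\<^sup>2) \<le> (?A + ?B)\<^sup>2"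
    using bound * by (intro suminf_le_const) auto
  then show "sqrt (\<Sum>i. (norm (a i + b i))\<^sup>2) \<le> ?A + ?B"
    using nonneg by (rule real_le_lsqrt[rotated])
qed

lemma l2_scaleR_aux:
  fixes a :: "nat \<Rightarrow> 'b :: real_normed_vector"
  assumes "summable (\<lambda>i. (norm (a i))\<^sup>2)"
  shows "summable (\<lambda>i. (norm (r *\<^sub>R a i))\<^sup>2)"
  using summable_mult[OF assms, of "\<bar>r\<bar>\<^sup>2"] by (simp add: power_mult_distrib)

instantiation l2 :: (real_normed_vector) real_normed_vector
begin

lift_definition zero_l2 :: "'a l2" is "\<lambda>_. 0" by simp
lift_definition plus_l2 :: "'a l2 \<Rightarrow> 'a l2 \<Rightarrow> 'a l2" is "\<lambda>a b i. a i + b i"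
  by (rule l2_summable_add)
lift_definition uminus_l2 :: "'a l2 \<Rightarrow> 'a l2" is "\<lambda>a i. - a i" by simp
lift_definition scaleR_l2 :: "real \<Rightarrow> 'a l2 \<Rightarrow> 'a l2" is "\<lambda>r a i. r *\<^sub>R a i"
  by (rule l2_scaleR_aux)
lift_definition norm_l2 :: "'a l2 \<Rightarrow> real" is "\<lambda>a. sqrt (\<Sum>i. (norm (a i))\<^sup>2)" .

definition minus_l2 :: "'a l2 \<Rightarrow> 'a l2 \<Rightarrow> 'a l2" where "minus_l2 a b = a + - b"
definition dist_l2 :: "'a l2 \<Rightarrow> 'a l2 \<Rightarrow> real" where "dist_l2 a b = norm (a - b)"
definition sgn_l2 :: "'a l2 \<Rightarrow> 'a l2" where "sgn_l2 a = inverse (norm a) *\<^sub>R a"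
definition uniformity_l2 :: "('a l2 \<times> 'a l2) filter" where
  "uniformity_l2 = (INF e\<in>{0<..}. principal {(x, y). dist x y < e})"
definition open_l2 :: "'a l2 set \<Rightarrow> bool" where
  "open_l2 U = (\<forall>x\<in>U. eventually (\<lambda>(x', y). x' = x \<longrightarrow> y \<in> U) uniformity)"

instance
proof
  fix a b c :: "'a l2" and r s :: real and U :: "'a l2 set"
  show "a + b + c = a + (b + c)" by transfer (simp add: add.assoc)
  show "a + b = b + a" by transfer (simp add: add.commute)
  show "0 + a = a" by transfer simp
  show "- a + a = 0" by transfer simp
  show "a - b = a + - b" by (rule minus_l2_def)
  show "r *\<^sub>R (a + b) = r *\<^sub>R a + r *\<^sub>R b" by transfer (simp add: scaleR_add_right)
  show "(r + s) *\<^sub>R a = r *\<^sub>R a + s *\<^sub>R a" by transfer (simp add: scaleR_add_left)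
  show "r *\<^sub>R s *\<^sub>R a = (r * s) *\<^sub>R a" by transfer simp
  show "1 *\<^sub>R a = a" by transfer simp
  show "dist a b = norm (a - b)" by (rule dist_l2_def)
  show "sgn a = inverse (norm a) *\<^sub>R a" by (rule sgn_l2_def)
  show "uniformity = (INF e\<in>{0<..}. principal {(x :: 'a l2, y). dist x y < e})"
    by (rule uniformity_l2_def)
  show "open U = (\<forall>x\<in>U. eventually (\<lambda>(x', y). x' = x \<longrightarrow> y \<in> U) uniformity)"
    by (rule open_l2_def)
  show "norm a = 0 \<longleftrightarrow> a = 0" by transfer (auto simp: suminf_eq_zero_iff)
  show "norm (a + b) \<le> norm a + norm b" by transfer (rule l2_summable_add)
  show "norm (r *\<^sub>R a) = \<bar>r\<bar> * norm a"
    by transfer (simp add: power_mult_distrib suminf_mult real_sqrt_mult)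
qed

end

instantiation l2 :: (complex_normed_vector) complex_normed_vector
begin

lift_definition scaleC_l2 :: "complex \<Rightarrow> 'a l2 \<Rightarrow> 'a l2" is "\<lambda>c a i. c *\<^sub>C a i"
  by (simp add: norm_scaleC power_mult_distrib summable_mult)

instance
proof
  fix a b :: "'a l2" and c d :: complex and r :: real
  show "c *\<^sub>C (a + b) = c *\<^sub>C a + c *\<^sub>C b" by transfer (simp add: scaleC_add_right)
  show "(c + d) *\<^sub>C a = c *\<^sub>C a + d *\<^sub>C a" by transfer (simp add: scaleC_add_left)
  show "c *\<^sub>C d *\<^sub>C a = (c * d) *\<^sub>C a" by transfer (simp add: scaleC_scaleC)
  show "complex_of_real r *\<^sub>C a = r *\<^sub>R a" by transfer (simp add: scaleC_of_real)
  show "norm (c *\<^sub>C a) = cmod c * norm a"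
    by transfer (simp add: norm_scaleC power_mult_distrib suminf_mult real_sqrt_mult)
qed

end

lift_definition l2_mult_right :: "'b l2 \<Rightarrow> 'b \<Rightarrow> 'b :: real_normed_algebra l2"
  is "\<lambda>a b i. a i * b"
proof -
  fix a :: "nat \<Rightarrow> 'b" and b :: 'b
  assume a: "summable (\<lambda>i. (norm (a i))\<^sup>2)"
  have "(norm (a i * b))\<^sup>2 \<le> (norm (a i))\<^sup>2 * (norm b)\<^sup>2" for i
    unfolding power_mult_distrib[symmetric] by (intro power_mono norm_mult_ineq) auto
  then show "summable (\<lambda>i. (norm (a i * b))\<^sup>2)"
    by (intro summable_comparison_test'[OF summable_mult2[OF a, of "(norm b)\<^sup>2"]]) auto
qed

definition l2_inner :: "'b l2 \<Rightarrow> 'b l2 \<Rightarrow> 'b :: cstar_algebra" where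
  "l2_inner a b = (\<Sum>i. adj (l2_nth b i) * l2_nth a i)"


section \<open>Operators on \<open>l\<^sup>2(\<nat>,B)\<close>\<close>

type_synonym 'b l2_op = "'b l2 \<Rightarrow>\<^sub>L 'b l2"

text \<open>
  The type \<open>'b l2_op\<close> contains all bounded real-linear maps; \<open>\<U>\<close> is the closed subalgebra of the
  complex-linear ones.
\<close>

definition bounded_ops :: "'b :: cstar_algebra l2_op set"  (\<open>\<U>\<close>) where
  "\<U> = {T. \<forall>c x. blinfun_apply T (c *\<^sub>C x) = c *\<^sub>C blinfun_apply T x}"

definition unitary_op :: "'b :: cstar_algebra l2_op \<Rightarrow> bool" where
  "unitary_op U \<longleftrightarrow> U \<in> \<U> \<and>
     (\<exists>V\<in>\<U>. U o\<^sub>L V = id_blinfun \<and> V o\<^sub>L U = id_blinfun) \<and>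
     (\<forall>a b. l2_inner (blinfun_apply U a) (blinfun_apply U b) = l2_inner a b)"

definition unitarily_equiv :: "'b :: cstar_algebra l2_op \<Rightarrow> 'b l2_op \<Rightarrow> bool" where
  "unitarily_equiv A A' \<longleftrightarrow> (\<exists>U. unitary_op U \<and> U o\<^sub>L A = A' o\<^sub>L U)"

definition unitarily_equiv_on ::
  "'z set \<Rightarrow> ('z \<Rightarrow> 'b :: cstar_algebra l2_op) \<Rightarrow> ('z \<Rightarrow> 'b l2_op) \<Rightarrow> bool" where
  "unitarily_equiv_on \<Omega> \<I>1 \<I>2 \<longleftrightarrow>
     (\<exists>U. unitary_op U \<and> (\<forall>z\<in>\<Omega>. U o\<^sub>L \<I>1 z = \<I>2 z o\<^sub>L U))"


section \<open>The class \<open>\<I>\<^sub>n(\<Omega>,\<U>)\<close>\<close>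

definition domain :: "(complex ^ 'm) set \<Rightarrow> bool" where
  "domain \<Omega> \<longleftrightarrow> open \<Omega> \<and> connected \<Omega> \<and> \<Omega> \<noteq> {}"

definition vec_holomorphic_on ::
  "(complex ^ 'm \<Rightarrow> 'a :: complex_normed_vector) \<Rightarrow> (complex ^ 'm) set \<Rightarrow> bool" where
  "vec_holomorphic_on f \<Omega> \<longleftrightarrow>
     (\<forall>z\<in>\<Omega>. \<exists>D. (f has_derivative D) (at z) \<and> (\<forall>c v. D (c *s v) = c *\<^sub>C D v))"

definition frame_op :: "('b :: cstar_algebra l2) ^ 'n \<Rightarrow> 'b ^ 'n \<Rightarrow> 'b l2" where
  "frame_op F \<xi> = (\<Sum>i\<in>UNIV. l2_mult_right (F $ i) (\<xi> $ i))"

definition frame_adj :: "('b :: cstar_algebra l2) ^ 'n \<Rightarrow> 'b l2 \<Rightarrow> 'b ^ 'n" where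
  "frame_adj G x = (\<chi> i. l2_inner x (G $ i))"

definition frame_gram ::
  "('b :: cstar_algebra l2) ^ 'n \<Rightarrow> 'b l2 ^ 'n \<Rightarrow> 'b ^ 'n ^ 'n" where
  "frame_gram G F = (\<chi> i j. l2_inner (F $ j) (G $ i))"

text \<open>
  The number \<open>n\<close> is the cardinality of the index type \<open>'n\<close>, passed as the argument \<open>TYPE('n)\<close>.
  Only the values of a map on \<open>\<Omega>\<close> are constrained.
\<close>

definition idem_maps ::
  "'n :: finite itself \<Rightarrow> (complex ^ 'm) set \<Rightarrow> (complex ^ 'm \<Rightarrow> 'b :: cstar_algebra l2_op) set"
where
  "idem_maps _ \<Omega> = {\<I>.
     (\<forall>z\<in>\<Omega>. \<I> z \<in> \<U>) \<and>
     (\<exists>F G :: complex ^ 'm \<Rightarrow> 'b l2 ^ 'n.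
        (\<forall>i. vec_holomorphic_on (\<lambda>z. F z $ i) \<Omega>) \<and>
        (\<forall>i. vec_holomorphic_on (\<lambda>z. G z $ i) \<Omega>) \<and>
        (\<forall>z\<in>\<Omega>. invertible (frame_gram (G z) (F z)) \<and>
          (\<forall>x. blinfun_apply (\<I> z) x =
             frame_op (F z) (matrix_inv (frame_gram (G z) (F z)) *v frame_adj (G z) x))))}"


section \<open>Curvature and covariant derivatives\<close>

text \<open>
  Directional derivative at \<open>z\<close> along \<open>v\<close>, in the norm topology, with the default value \<open>0\<close> where
  it does not exist. The maps in \<open>idem_maps\<close> are real-analytic on \<open>\<Omega>\<close>, so on \<open>\<Omega>\<close> the default is
  never used in the derivatives below.
\<close>

definition dir_deriv ::
  "complex ^ 'm \<Rightarrow> (complex ^ 'm \<Rightarrow> 'a :: real_normed_vector) \<Rightarrow> complex ^ 'm \<Rightarrow> 'a" where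
  "dir_deriv v f z =
     (if (\<lambda>t :: real. f (z + t *\<^sub>R v)) differentiable (at 0)
      then vector_derivative (\<lambda>t. f (z + t *\<^sub>R v)) (at 0) else 0)"

definition wirt ::
  "'m \<Rightarrow> (complex ^ 'm \<Rightarrow> 'a :: complex_normed_vector) \<Rightarrow> complex ^ 'm \<Rightarrow> 'a" where
  "wirt i f z = (1/2) *\<^sub>C (dir_deriv (axis i 1) f z - \<i> *\<^sub>C dir_deriv (axis i \<i>) f z)"

definition wirt_bar ::
  "'m \<Rightarrow> (complex ^ 'm \<Rightarrow> 'a :: complex_normed_vector) \<Rightarrow> complex ^ 'm \<Rightarrow> 'a" where
  "wirt_bar i f z = (1/2) *\<^sub>C (dir_deriv (axis i 1) f z + \<i> *\<^sub>C dir_deriv (axis i \<i>) f z)"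

definition curvature ::
  "(complex ^ 'm \<Rightarrow> 'b :: cstar_algebra l2_op) \<Rightarrow> complex ^ 'm \<Rightarrow> 'b l2_op" where
  "curvature \<I> z = (\<Sum>j\<in>UNIV. wirt_bar j \<I> z) o\<^sub>L (\<Sum>i\<in>UNIV. wirt i \<I> z)"

datatype 'm letter = Unbarred 'm | Barred 'm

fun barred :: "'m letter \<Rightarrow> bool" where
  "barred (Unbarred _) = False"
| "barred (Barred _) = True"

definition is_order :: "'m letter list \<Rightarrow> ('m \<Rightarrow> nat) \<Rightarrow> ('m \<Rightarrow> nat) \<Rightarrow> bool" where
  "is_order w I J \<longleftrightarrow>
     (\<forall>p. count_list w (Unbarred p) = I p) \<and> (\<forall>q. count_list w (Barred q) = J q)"

text \<open>
  Words are applied from left to right, so the recursion removes the last letter.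
\<close>

function cov_deriv ::
  "(complex ^ 'm \<Rightarrow> 'b :: cstar_algebra l2_op) \<Rightarrow> 'm letter list \<Rightarrow> complex ^ 'm \<Rightarrow> 'b l2_op"
where
  "cov_deriv \<I> [] = curvature \<I>"
| "cov_deriv \<I> (w @ [Unbarred l]) = (\<lambda>z.
     (if \<exists>x\<in>set w. \<not> barred x \<and> x \<noteq> Unbarred l
      then cov_deriv \<I> (filter (\<lambda>x. x \<noteq> Unbarred l) w) z else 0)
     + (\<I> z o\<^sub>L wirt l (cov_deriv \<I> (filter (\<lambda>x. barred x \<or> x = Unbarred l) w)) z))"
| "cov_deriv \<I> (w @ [Barred k]) = (\<lambda>z.
     (if \<exists>x\<in>set w. barred x \<and> x \<noteq> Barred k
      then cov_deriv \<I> (filter (\<lambda>x. x \<noteq> Barred k) w) z else 0)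
     + (wirt_bar k (cov_deriv \<I> (filter (\<lambda>x. \<not> barred x \<or> x = Barred k) w)) z o\<^sub>L \<I> z))"
proof -
  fix P :: bool and x :: "(complex ^ 'm \<Rightarrow> 'b l2_op) \<times> 'm letter list"
  assume nil: "\<And>\<I>. x = (\<I>, []) \<Longrightarrow> P"
    and unb: "\<And>\<I> w l. x = (\<I>, w @ [Unbarred l]) \<Longrightarrow> P"
    and bar: "\<And>\<I> w k. x = (\<I>, w @ [Barred k]) \<Longrightarrow> P"
  obtain \<I> v where x: "x = (\<I>, v)" by force
  show P
  proof (cases v rule: rev_cases)
    case Nil
    with nil x show P by blast
  next
    case (snoc w a)
    with unb bar x show P by (cases a) blast+
  qed
qed auto
termination
  by (relation "Wellfounded.measure (\<lambda>(_, w). length w)") (auto simp: less_Suc_eq_le)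

end

theory Submission
  imports Defs
begin

text \<open>
  Conjugation by the intertwining unitary transports everything that the covariant derivatives are
  built from. Let \<open>U\<close> be a unitary with inverse \<open>V\<close> and \<open>U o\<^sub>L \<I>1 z = \<I>2 z o\<^sub>L U\<close> on \<open>\<Omega>\<close>, and put
  \<open>conj_op U V T = U o\<^sub>L T o\<^sub>L V\<close>, so that \<open>\<I>2 = conj_op U V \<circ> \<I>1\<close> on \<open>\<Omega>\<close>. This map is a continuous
  complex-linear automorphism of the algebra of operators, and it does not depend on \<open>z\<close>. It
  therefore commutes with products and sums, and with the Wirtinger derivatives
  (\<open>wirt_linear_iso\<close>, \<open>wirt_bar_linear_iso\<close>). Since \<open>\<Omega>\<close> is open, an identity valid on \<open>\<Omega>\<close> may be
  differentiated there. Hence it passes to the curvature and, by induction on the length of the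
  word, to all covariant derivatives (\<open>cov_deriv_conj\<close>): one and the same unitary intertwines them
  at every point of \<open>\<Omega>\<close>.
\<close>

text \<open>
  The left inverse \<open>D\<close> is there for the default value of \<^const>\<open>dir_deriv\<close>: if \<open>f\<close> is not
  differentiable along \<open>v\<close>, then \<open>C \<circ> f\<close> must not be either, because \<open>f = D \<circ> C \<circ> f\<close>.
\<close>

lemma dir_deriv_linear_iso:
  fixes f :: "complex ^ 'm \<Rightarrow> 'a :: real_normed_vector"
    and g :: "complex ^ 'm \<Rightarrow> 'c :: real_normed_vector"
  assumes C: "bounded_linear C" and D: "bounded_linear D" and DC: "\<And>x. D (C x) = x"
    and "open \<Omega>" "z \<in> \<Omega>" and g: "\<And>y. y \<in> \<Omega> \<Longrightarrow> g y = C (f y)"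
  shows "dir_deriv v g z = C (dir_deriv v f z)"
proof -
  let ?f = "\<lambda>t::real. f (z + t *\<^sub>R v)" and ?g = "\<lambda>t::real. g (z + t *\<^sub>R v)"
  let ?S = "(\<lambda>t::real. z + t *\<^sub>R v) -` \<Omega>"
  have S: "open ?S"
    by (intro open_vimage \<open>open \<Omega>\<close> continuous_intros)
  have S0: "0 \<in> ?S" using \<open>z \<in> \<Omega>\<close> by simp
  have f_imp: "(?g has_vector_derivative C d) (at 0)"
    if "(?f has_vector_derivative d) (at 0)" for d
    using bounded_linear.has_vector_derivative[OF C that] S S0
    by (rule has_vector_derivative_transform_within_open) (simp add: g)
  have g_imp: "(?f has_vector_derivative D d) (at 0)"
    if "(?g has_vector_derivative d) (at 0)" for d
    using bounded_linear.has_vector_derivative[OF D that] S S0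
    by (rule has_vector_derivative_transform_within_open) (simp add: g DC)
  show ?thesis
  proof (cases "?f differentiable (at 0)")
    case True
    have d: "(?g has_vector_derivative C (vector_derivative ?f (at 0))) (at 0)"
      using f_imp True by (simp add: vector_derivative_works)
    then have "?g differentiable (at 0)"
      by (rule differentiableI_vector)
    with True vector_derivative_at[OF d] show ?thesis
      by (simp add: dir_deriv_def)
  next
    case False
    then have "\<not> ?g differentiable (at 0)"
      using g_imp by (meson differentiableI_vector vector_derivative_works)
    with False show ?thesis
      by (simp add: dir_deriv_def linear_0[OF bounded_linear.linear[OF C]])
  qed
qed

lemma
  fixes f :: "complex ^ 'm \<Rightarrow> 'a :: complex_normed_vector"
    and g :: "complex ^ 'm \<Rightarrow> 'c :: complex_normed_vector"
  assumes C: "bounded_linear C" and D: "bounded_linear D" and DC: "\<And>x. D (C x) = x"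
    and scale: "\<And>c x. C (c *\<^sub>C x) = c *\<^sub>C C x"
    and \<Omega>: "open \<Omega>" "z \<in> \<Omega>" and g: "\<And>y. y \<in> \<Omega> \<Longrightarrow> g y = C (f y)"
  shows wirt_linear_iso: "wirt i g z = C (wirt i f z)"
    and wirt_bar_linear_iso: "wirt_bar i g z = C (wirt_bar i f z)"
proof -
  interpret C: bounded_linear C by (rule C)
  note deriv = dir_deriv_linear_iso[OF C D DC \<Omega> g]
  show "wirt i g z = C (wirt i f z)" "wirt_bar i g z = C (wirt_bar i f z)"
    by (simp_all add: wirt_def wirt_bar_def deriv scale C.add C.diff)
qed

definition conj_op ::
  "('a::real_normed_vector \<Rightarrow>\<^sub>L 'a) \<Rightarrow> ('a \<Rightarrow>\<^sub>L 'a) \<Rightarrow> ('a \<Rightarrow>\<^sub>L 'a) \<Rightarrow> ('a \<Rightarrow>\<^sub>L 'a)" where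
  "conj_op U V T = U o\<^sub>L T o\<^sub>L V"

lemma bounded_linear_conj_op: "bounded_linear (conj_op U V)"
  unfolding conj_op_def by (intro bounded_linear_intros)

lemma conj_op_inverse:
  assumes "V o\<^sub>L U = id_blinfun"
  shows "conj_op V U (conj_op U V T) = T"
proof (rule blinfun_eqI)
  fix x
  have "blinfun_apply V (blinfun_apply U y) = y" for y
    using arg_cong[OF assms, of "\<lambda>W. blinfun_apply W y"] by simp
  then show "blinfun_apply (conj_op V U (conj_op U V T)) x = blinfun_apply T x"
    by (simp add: conj_op_def)
qed

lemma conj_op_compose:
  assumes "V o\<^sub>L U = id_blinfun"
  shows "conj_op U V (S o\<^sub>L T) = conj_op U V S o\<^sub>L conj_op U V T"
proof (rule blinfun_eqI)
  fix x
  have "blinfun_apply V (blinfun_apply U y) = y" for y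
    using arg_cong[OF assms, of "\<lambda>W. blinfun_apply W y"] by simp
  then show "blinfun_apply (conj_op U V (S o\<^sub>L T)) x
      = blinfun_apply (conj_op U V S o\<^sub>L conj_op U V T) x"
    by (simp add: conj_op_def)
qed

lemma conj_op_scaleC:
  assumes "U \<in> \<U>"
  shows "conj_op U V (c *\<^sub>C T) = c *\<^sub>C conj_op U V T"
  by (rule blinfun_eqI) (use assms in \<open>simp add: conj_op_def bounded_ops_def scaleC_blinfun.rep_eq\<close>)

lemma intertwine_iff_conj_op:
  assumes "U o\<^sub>L V = id_blinfun" "V o\<^sub>L U = id_blinfun"
  shows "U o\<^sub>L A = A' o\<^sub>L U \<longleftrightarrow> A' = conj_op U V A"
proof -
  have UV: "blinfun_apply U (blinfun_apply V y) = y"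
    and VU: "blinfun_apply V (blinfun_apply U y) = y" for y
    using arg_cong[OF assms(1), of "\<lambda>W. blinfun_apply W y"]
      arg_cong[OF assms(2), of "\<lambda>W. blinfun_apply W y"] by simp_all
  show ?thesis
  proof
    assume "U o\<^sub>L A = A' o\<^sub>L U"
    then have "blinfun_apply U (blinfun_apply A y) = blinfun_apply A' (blinfun_apply U y)" for y
      by (metis blinfun_apply_blinfun_compose)
    then show "A' = conj_op U V A"
      by (intro blinfun_eqI) (simp add: conj_op_def UV)
  next
    assume "A' = conj_op U V A"
    then show "U o\<^sub>L A = A' o\<^sub>L U"
      by (intro blinfun_eqI) (simp add: conj_op_def VU)
  qed
qed

text \<open>
  The conclusion is needed on all of \<open>\<Omega>\<close> at once, not at a single point: the recursion
  differentiates the covariant derivatives along shorter words.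
\<close>

lemma cov_deriv_conj:
  fixes \<I>1 \<I>2 :: "complex ^ 'm \<Rightarrow> 'b :: cstar_algebra l2_op"
  assumes "open \<Omega>" and "U \<in> \<U>"
    and UV: "U o\<^sub>L V = id_blinfun" and VU: "V o\<^sub>L U = id_blinfun"
    and conj: "\<And>z. z \<in> \<Omega> \<Longrightarrow> \<I>2 z = conj_op U V (\<I>1 z)"
  shows "\<forall>z\<in>\<Omega>. cov_deriv \<I>2 w z = conj_op U V (cov_deriv \<I>1 w z)"
proof -
  interpret C: bounded_linear "conj_op U V" by (rule bounded_linear_conj_op)
  note iso = bounded_linear_conj_op bounded_linear_conj_op conj_op_inverse[OF VU]
    conj_op_scaleC[OF \<open>U \<in> \<U>\<close>] \<open>open \<Omega>\<close>
  note comp = conj_op_compose[OF VU]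
  show ?thesis
  proof (induction w rule: length_induct)
    case (1 w)
    then have IH: "cov_deriv \<I>2 v z = conj_op U V (cov_deriv \<I>1 v z)"
      if "length v < length w" "z \<in> \<Omega>" for v z using that by blast
    show ?case
    proof
      fix z assume z: "z \<in> \<Omega>"
      show "cov_deriv \<I>2 w z = conj_op U V (cov_deriv \<I>1 w z)"
      proof (cases w rule: rev_cases)
        case Nil
        then show ?thesis
          by (simp add: curvature_def comp C.sum wirt_linear_iso[OF iso z conj]
              wirt_bar_linear_iso[OF iso z conj])
      next
        case (snoc v a)
        then have IH': "cov_deriv \<I>2 (filter P v) y = conj_op U V (cov_deriv \<I>1 (filter P v) y)"
          if "y \<in> \<Omega>" for P y
          using IH[OF _ that] by (simp add: less_Suc_eq_le)
        show ?thesis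
        proof (cases a)
          case (Unbarred l)
          with snoc show ?thesis
            by (auto simp add: IH'[OF z] conj[OF z] wirt_linear_iso[OF iso z IH'] comp C.add C.zero)
        next
          case (Barred k)
          with snoc show ?thesis
            by (auto simp add: IH'[OF z] conj[OF z] wirt_bar_linear_iso[OF iso z IH'] comp C.add C.zero)
        qed
      qed
    qed
  qed
qed

theorem theorem2p11:
  fixes \<Omega> :: "(complex ^ 'm) set"
    and \<I>1 \<I>2 :: "complex ^ 'm \<Rightarrow> 'b :: cstar_algebra l2_op"
  assumes "domain \<Omega>"
    and "\<I>1 \<in> idem_maps TYPE('n :: finite) \<Omega>"
    and "\<I>2 \<in> idem_maps TYPE('n) \<Omega>"
    and "unitarily_equiv_on \<Omega> \<I>1 \<I>2"
  shows "\<forall>z\<in>\<Omega>. \<forall>I J. \<forall>w. is_order w I J \<longrightarrow>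
           unitarily_equiv (cov_deriv \<I>1 w z) (cov_deriv \<I>2 w z)"
proof -
  obtain U where U: "unitary_op U" and eq: "\<And>z. z \<in> \<Omega> \<Longrightarrow> U o\<^sub>L \<I>1 z = \<I>2 z o\<^sub>L U"
    using assms(4) unfolding unitarily_equiv_on_def by blast
  from U obtain V where "U \<in> \<U>" and V: "U o\<^sub>L V = id_blinfun" "V o\<^sub>L U = id_blinfun"
    unfolding unitary_op_def by blast
  have "\<forall>z\<in>\<Omega>. cov_deriv \<I>2 w z = conj_op U V (cov_deriv \<I>1 w z)" for w
    using assms(1) \<open>U \<in> \<U>\<close> V eq
    by (intro cov_deriv_conj) (auto simp: domain_def simp flip: intertwine_iff_conj_op[OF V])
  then have "\<forall>z\<in>\<Omega>. U o\<^sub>L cov_deriv \<I>1 w z = cov_deriv \<I>2 w z o\<^sub>L U" for w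
    by (simp add: intertwine_iff_conj_op[OF V])
  with U show ?thesis
    unfolding unitarily_equiv_def by blast
qed

end
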